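(* Let $\mathcal U$ be a risk frontier with a temporal decomposition given by tail risk frontiers $\{\mathcal U_{t:T}\}_{t\in[T]}$, and let $\{\varrho_{\mathcal U,t:T}\}_{t\in[T]}$ be the induced dynamic risk measure. Suppose the following holds: whenever $0\le t_1<t_2\le T$, $[(X_{t_1:T},Z_{t_1:T},\Phi_{t_1:T})\mid h_{t_1}]\in\mathcal U_{t_1:T}(h_{t_1})$ for all $h_{t_1}\in\mathbb H_{t_1}$, and $[(X'_{t_2:T},Z'_{t_2:T},\Phi'_{t_2:T})\mid h_{t_2}]\in\mathcal U_{t_2:T}(h_{t_2})$ with $\Phi'_{t_2}(h_{t_2})\le\Phi_{t_2}(h_{t_2})$ for all $h_{t_2}\in\mathbb H_{t_2}$, then the triple $(\tilde X_{t_1:T},\tilde Z_{t_1:T},\tilde\Phi_{t_1:T})$ defined by $$(\tilde X_k,\tilde Z_k,\tilde\Phi_k)=(X_k,Z_k,\Phi_k)\ \ (k\in[t_1,t_2-1]),\qquad (\tilde X_k,\tilde Z_k,\tilde\Phi_k)=(X'_k,Z'_k,\Phi'_k)\ \ (k\in[t_2,T])$$ satisfies $[(\tilde X_{t_1:T},\tilde Z_{t_1:T},\tilde\Phi_{t_1:T})\mid h_{t_1}]\in\mathcal U_{t_1:T}(h_{t_1})$ for all $h_{t_1}\in\mathbb H_{t_1}$. Then $\{\varrho_{\mathcal U,t:T}\}_{t\in[T]}$ is time-consistent: for all $0\le t_1<t_2\le T$ and all $X_{t_1:T},Y_{t_1:T}\in\mathcal L_{t_1+1:T+1}$, the conditions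 $X_k=Y_k$ for $k\in[t_1,t_2-1]$ and $\varrho_{\mathcal U,t_2:T}(X_{t_2:T})\le\varrho_{\mathcal U,t_2:T}(Y_{t_2:T})$ imply $\varrho_{\mathcal U,t_1:T}(X_{t_1:T})\le\varrho_{\mathcal U,t_1:T}(Y_{t_1:T})$.
   Context: Notation: $[n]=\{0,1,\dots,n\}$, $[n_1,n_2]=\{n_1,\dots,n_2\}$. Fix a horizon $0\le T<\infty$. The data space $\Xi$ and state space $\mathbb S$ are finite, the initial state $s_0\in\mathbb S$ is fixed, and states evolve by $s_{t+1}=f_t(s_t,\xi_t)$ with $f_t:\mathbb S\times\Xi\to\mathbb S$, $t\in[T-1]$. $\Omega$ is the finite set of trajectories $\omega=(s_0,\xi_0,\dots,\xi_T)$, with a probability measure $\mathbb P$. For $t\in[T+1]$, $h_t=(s_0,\xi_0,\dots,\xi_{t-1})$ is the history up to the beginning of period $t$, $\mathbb H_t$ is the set of such histories, $\mathscr F_t=\sigma(h_t)$, and $\mathcal L_t=\mathcal L^\infty(\Omega,\mathscr F_t,\mathbb P)$. Put $\mathcal L_{t:T}=\prod_{k=t}^{T}\mathcal L_k$ and $\mathcal L_{t+1:T+1}=\prod_{k=t+1}^{T+1}\mathcal L_k$. A (tail) payoff stream is $X_{t:T}\in\mathcal L_{t+1:T+1}$ with $X_k\in\mathcal L_{k+1}$; a (tail) disbursement strategy is $Z_{t:T}\in\mathcal L_{t:T}$ and a (tail) premium schedule is $\Phi_{t:T}\in\mathcal L_{t:T}$, with $Z_k,\Phi_k\in\mathcal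 L_k$. $\Phi_0$ is a constant, denoted $\varphi_0$. Inequalities hold componentwise and almost surely. $[X\mid h_t]$ denotes the conditional random variable (or process) $X$ given the history $h_t$. The decision maker has perfect recall: $h_t$ determines the past values $(X_{0:t-1},Z_{0:t-1},\Phi_{0:t-1})$. Risk frontier: a set $\mathcal U\subset\mathcal L_{1:T+1}\times\mathcal L_{0:T}\times\mathcal L_{0:T}$ is a risk frontier if: (i) $(X_{0:T},Z_{0:T},\Phi_{0:T})\in\mathcal U$ implies $(X'_{0:T},Z_{0:T},\Phi_{0:T})\in\mathcal U$ for all $X'_{0:T}\ge X_{0:T}$; (ii) $(X_{0:T},Z_{0:T},\Phi_{0:T})\in\mathcal U$ implies $(X_{0:T},Z_{0:T},\Phi_{0:T}+\Phi'_{0:T})\in\mathcal U$ for all non-increasing processes $\Phi'_{0:T}\ge 0$, i.e. $\Phi'_t(h_t)\ge\mathbb E[\Phi'_{t+1}\mid h_t]$ for all $h_t\in\mathbb H_t$ and $t\in[T-1]$; (iii) $(X_{0:T},Z_{0:T},\Phi_{0:T})\in\mathcal U$ and $Z'_{0:T}\ge Z_{0:T}$ imply $(X_{0:T},Z'_{0:T},\Phi'_{0:T})\in\mathcal U$ for some $\Phi'_{0:T}\ge\Phi_{0:T}$; (iv) $\mathcal U$ is closed. Temporal decomposition: $\mathcal U$ has a temporal decomposition when there exist correspondences (set-valued maps) $\mathcal U_{t:T}:\mathbb H_t\rightrightarrows\mathcal L_{t+1:T+1}\times\mathcal L_{t:T}\times\mathcal L_{t:T}$, $t\in[T]$, called tail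 risk frontiers, such that $$\mathcal U=\{(X_{0:T},Z_{0:T},\Phi_{0:T}):[(X_{t:T},Z_{t:T},\Phi_{t:T})\mid h_t]\in\mathcal U_{t:T}(h_t),\ \forall h_t\in\mathbb H_t,\ \forall t\in[T]\}.$$ Induced dynamic risk measure: $\varrho_{\mathcal U,t:T}:\mathcal L_{t+1:T+1}\to\mathcal L_t$, $$[\varrho_{\mathcal U,t:T}(X_{t:T})](h_t)=\min_{Z_{t:T},\Phi_{t:T}}\{\Phi_t(h_t):[(X_{t:T},Z_{t:T},\Phi_{t:T})\mid h_t]\in\mathcal U_{t:T}(h_t)\},\quad h_t\in\mathbb H_t,$$ where the minima are understood to exist (the map takes values in $\mathcal L_t$).
   Formalization: Added assumption: for t1<t2≤T, if a triple is acceptable in U_{t1:T}(h_{t1}) for all h_{t1}, its tail from t2 is acceptable in U_{t2:T}(h_{t2}) for all h_{t2}; without it the claim is false. Histories range over those of positive probability. *)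

theory Defs
  imports "HOL-Probability.Probability"
begin

text \<open>
  A trajectory \<open>(s\<^sub>0, \<xi>\<^sub>0, \<dots>, \<xi>\<^sub>T)\<close> is the pair of the initial state and the list of data;
  a history \<open>h\<^sub>t = (s\<^sub>0, \<xi>\<^sub>0, \<dots>, \<xi>\<^bsub>t-1\<^esub>)\<close> has the same form, with a list of length \<open>t\<close>.
  The later states are functions of these data (through \<open>s\<^bsub>t+1\<^esub> = f\<^sub>t(s\<^sub>t, \<xi>\<^sub>t)\<close>) and enter none of
  the notions below.
\<close>

type_synonym ('s, 'x) trajectory = "'s \<times> 'x list"

type_synonym ('s, 'x) process = "nat \<Rightarrow> ('s, 'x) trajectory \<Rightarrow> real"

type_synonym ('s, 'x) triple =
  "('s, 'x) process \<times> ('s, 'x) process \<times> ('s, 'x) process"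

definition trajectories :: "'s \<Rightarrow> nat \<Rightarrow> ('s, 'x) trajectory set" where
  "trajectories s0 T = {(s0, xs) |xs. length xs = Suc T}"

definition hist :: "nat \<Rightarrow> ('s, 'x) trajectory \<Rightarrow> ('s, 'x) trajectory" where
  "hist t \<omega> = (fst \<omega>, take t (snd \<omega>))"

text \<open>
  Elements of \<open>L\<^sup>\<infinity>\<close> are determined only almost surely and so have no value at a history of
  probability zero.  Hence \<open>H\<^sub>t\<close> consists of the histories of positive probability; this is every
  history if \<open>P\<close> charges every trajectory.
\<close>

definition histories :: "('s, 'x) trajectory measure \<Rightarrow> nat \<Rightarrow> ('s, 'x) trajectory set" where
  "histories P t = {h. measure P {\<omega> \<in> space P. hist t \<omega> = h} > 0}"

definition hist_algebra ::
  "('s, 'x) trajectory measure \<Rightarrow> nat \<Rightarrow> ('s, 'x) trajectory measure" where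
  "hist_algebra P t = vimage_algebra (space P) (hist t) (count_space UNIV)"

text \<open>
  Essential boundedness is automatic, the space of trajectories being finite.  We work with
  representatives instead of almost sure equivalence classes; sets of (tuples of) \<open>L\<^sup>\<infinity>\<close> elements are
  sets of representatives saturated under almost sure equality, see \<open>Linf_triple_set\<close>.
\<close>

definition Linf :: "('s, 'x) trajectory measure \<Rightarrow> nat \<Rightarrow> (('s, 'x) trajectory \<Rightarrow> real) set" where
  "Linf P t = borel_measurable (hist_algebra P t)"

text \<open>
  \<open>adapted P T t\<close> and \<open>payoffs P T t\<close> are \<open>L\<^bsub>t:T\<^esub>\<close> and \<open>L\<^bsub>t+1:T+1\<^esub>\<close>, the latter with
  \<open>X\<^sub>k \<in> L\<^bsub>k+1\<^esub>\<close> for \<open>t \<le> k \<le> T\<close>.  The components outside \<open>{t..T}\<close> are irrelevant, so the tail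
  \<open>X\<^bsub>t:T\<^esub>\<close> of a process \<open>X\<close> is represented by \<open>X\<close> itself.
\<close>

definition adapted :: "('s, 'x) trajectory measure \<Rightarrow> nat \<Rightarrow> nat \<Rightarrow> ('s, 'x) process set" where
  "adapted P T t = {Z. \<forall>k\<in>{t..T}. Z k \<in> Linf P k}"

definition payoffs :: "('s, 'x) trajectory measure \<Rightarrow> nat \<Rightarrow> nat \<Rightarrow> ('s, 'x) process set" where
  "payoffs P T t = {X. \<forall>k\<in>{t..T}. X k \<in> Linf P (Suc k)}"

definition triples :: "('s, 'x) trajectory measure \<Rightarrow> nat \<Rightarrow> nat \<Rightarrow> ('s, 'x) triple set" where
  "triples P T t = payoffs P T t \<times> adapted P T t \<times> adapted P T t"

definition proc_eq ::
  "('s, 'x) trajectory measure \<Rightarrow> nat \<Rightarrow> nat \<Rightarrow> ('s, 'x) process \<Rightarrow> ('s, 'x) process \<Rightarrow> bool" where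
  "proc_eq P T t A B \<longleftrightarrow> (\<forall>k\<in>{t..T}. AE \<omega> in P. A k \<omega> = B k \<omega>)"

definition proc_le ::
  "('s, 'x) trajectory measure \<Rightarrow> nat \<Rightarrow> nat \<Rightarrow> ('s, 'x) process \<Rightarrow> ('s, 'x) process \<Rightarrow> bool" where
  "proc_le P T t A B \<longleftrightarrow> (\<forall>k\<in>{t..T}. AE \<omega> in P. A k \<omega> \<le> B k \<omega>)"

definition Linf_triple_set ::
  "('s, 'x) trajectory measure \<Rightarrow> nat \<Rightarrow> nat \<Rightarrow> ('s, 'x) triple set \<Rightarrow> bool" where
  "Linf_triple_set P T t A \<longleftrightarrow> A \<subseteq> triples P T t \<and>
     (\<forall>X Z \<Phi> X' Z' \<Phi>'. (X, Z, \<Phi>) \<in> A \<longrightarrow> (X', Z', \<Phi>') \<in> triples P T t \<longrightarrow>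
        proc_eq P T t X X' \<longrightarrow> proc_eq P T t Z Z' \<longrightarrow> proc_eq P T t \<Phi> \<Phi>' \<longrightarrow> (X', Z', \<Phi>') \<in> A)"

text \<open>Closedness in the essential supremum norm of the finite product of \<open>L\<^sup>\<infinity>\<close> spaces.\<close>

definition proc_near ::
  "('s, 'x) trajectory measure \<Rightarrow> nat \<Rightarrow> real \<Rightarrow> ('s, 'x) process \<Rightarrow> ('s, 'x) process \<Rightarrow> bool" where
  "proc_near P T e A B \<longleftrightarrow> (\<forall>k\<in>{0..T}. AE \<omega> in P. \<bar>A k \<omega> - B k \<omega>\<bar> < e)"

definition Linf_closed :: "('s, 'x) trajectory measure \<Rightarrow> nat \<Rightarrow> ('s, 'x) triple set \<Rightarrow> bool" where
  "Linf_closed P T U \<longleftrightarrow> (\<forall>X Z \<Phi>. (X, Z, \<Phi>) \<in> triples P T 0 \<longrightarrow>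
     (\<forall>e>0. \<exists>X' Z' \<Phi>'. (X', Z', \<Phi>') \<in> U \<and>
        proc_near P T e X' X \<and> proc_near P T e Z' Z \<and> proc_near P T e \<Phi>' \<Phi>) \<longrightarrow>
     (X, Z, \<Phi>) \<in> U)"

definition nonincreasing_process ::
  "('s, 'x) trajectory measure \<Rightarrow> nat \<Rightarrow> ('s, 'x) process \<Rightarrow> bool" where
  "nonincreasing_process P T \<Phi> \<longleftrightarrow>
     (\<forall>t<T. AE \<omega> in P. \<Phi> t \<omega> \<ge> real_cond_exp P (hist_algebra P t) (\<Phi> (Suc t)) \<omega>)"

definition risk_frontier :: "('s, 'x) trajectory measure \<Rightarrow> nat \<Rightarrow> ('s, 'x) triple set \<Rightarrow> bool" where
  "risk_frontier P T U \<longleftrightarrow>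
     Linf_triple_set P T 0 U \<and>
     (\<forall>X Z \<Phi>. \<forall>X'\<in>payoffs P T 0.
        (X, Z, \<Phi>) \<in> U \<longrightarrow> proc_le P T 0 X X' \<longrightarrow> (X', Z, \<Phi>) \<in> U) \<and>
     (\<forall>X Z \<Phi>. \<forall>\<Phi>'\<in>adapted P T 0.
        (X, Z, \<Phi>) \<in> U \<longrightarrow> nonincreasing_process P T \<Phi>' \<longrightarrow> proc_le P T 0 (\<lambda>k \<omega>. 0) \<Phi>' \<longrightarrow>
        (X, Z, \<lambda>k \<omega>. \<Phi> k \<omega> + \<Phi>' k \<omega>) \<in> U) \<and>
     (\<forall>X Z \<Phi>. \<forall>Z'\<in>adapted P T 0.
        (X, Z, \<Phi>) \<in> U \<longrightarrow> proc_le P T 0 Z Z' \<longrightarrow>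
        (\<exists>\<Phi>'\<in>adapted P T 0. proc_le P T 0 \<Phi> \<Phi>' \<and> (X, Z', \<Phi>') \<in> U)) \<and>
     Linf_closed P T U"

text \<open>
  \<open>[A | h]\<close> is the restriction of \<open>A\<close> to the trajectories that continue \<open>h\<close>, extended by zero so
  that it is again an element of the product of \<open>L\<^sup>\<infinity>\<close> spaces.
\<close>

definition cond_proc ::
  "nat \<Rightarrow> ('s, 'x) trajectory \<Rightarrow> ('s, 'x) process \<Rightarrow> ('s, 'x) process" where
  "cond_proc t h A = (\<lambda>k \<omega>. if hist t \<omega> = h then A k \<omega> else 0)"

definition cond_triple ::
  "nat \<Rightarrow> ('s, 'x) trajectory \<Rightarrow> ('s, 'x) triple \<Rightarrow> ('s, 'x) triple" where
  "cond_triple t h = (\<lambda>(X, Z, \<Phi>). (cond_proc t h X, cond_proc t h Z, cond_proc t h \<Phi>))"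

text \<open>The value \<open>Y(h)\<close> at \<open>h \<in> H\<^sub>t\<close> of a random variable \<open>Y\<close> that is measurable with respect to \<open>h\<^sub>t\<close>.\<close>

definition hist_val ::
  "('s, 'x) trajectory measure \<Rightarrow> nat \<Rightarrow> (('s, 'x) trajectory \<Rightarrow> real) \<Rightarrow>
   ('s, 'x) trajectory \<Rightarrow> real" where
  "hist_val P t Y h = (THE c. \<forall>\<omega>\<in>space P. hist t \<omega> = h \<longrightarrow> Y \<omega> = c)"

definition temporal_decomposition ::
  "('s, 'x) trajectory measure \<Rightarrow> nat \<Rightarrow> ('s, 'x) triple set \<Rightarrow>
   (nat \<Rightarrow> ('s, 'x) trajectory \<Rightarrow> ('s, 'x) triple set) \<Rightarrow> bool" where
  "temporal_decomposition P T U UT \<longleftrightarrow>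
     (\<forall>t\<le>T. \<forall>h\<in>histories P t. Linf_triple_set P T t (UT t h)) \<and>
     U = {W \<in> triples P T 0. \<forall>t\<le>T. \<forall>h\<in>histories P t. cond_triple t h W \<in> UT t h}"

text \<open>
  Tails of processes that are acceptable from \<open>t1\<close> on are acceptable from any later \<open>t2\<close> on.  This
  does not follow from \<open>temporal_decomposition\<close>, which constrains the tail risk frontiers only jointly
  and allows each single one of them to contain triples whose later tails are not acceptable.
\<close>

definition nested_tails ::
  "('s, 'x) trajectory measure \<Rightarrow> nat \<Rightarrow>
   (nat \<Rightarrow> ('s, 'x) trajectory \<Rightarrow> ('s, 'x) triple set) \<Rightarrow> bool" where
  "nested_tails P T UT \<longleftrightarrow>
     (\<forall>t1 t2. t1 < t2 \<longrightarrow> t2 \<le> T \<longrightarrow> (\<forall>W\<in>triples P T t1.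
        (\<forall>h\<in>histories P t1. cond_triple t1 h W \<in> UT t1 h) \<longrightarrow>
        (\<forall>h\<in>histories P t2. cond_triple t2 h W \<in> UT t2 h)))"

definition premium_values ::
  "('s, 'x) trajectory measure \<Rightarrow> nat \<Rightarrow>
   (nat \<Rightarrow> ('s, 'x) trajectory \<Rightarrow> ('s, 'x) triple set) \<Rightarrow>
   nat \<Rightarrow> ('s, 'x) process \<Rightarrow> ('s, 'x) trajectory \<Rightarrow> real set" where
  "premium_values P T UT t X h =
     {hist_val P t (\<Phi> t) h |Z \<Phi>. Z \<in> adapted P T t \<and> \<Phi> \<in> adapted P T t \<and>
        cond_triple t h (X, Z, \<Phi>) \<in> UT t h}"

definition minima_exist ::
  "('s, 'x) trajectory measure \<Rightarrow> nat \<Rightarrow>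
   (nat \<Rightarrow> ('s, 'x) trajectory \<Rightarrow> ('s, 'x) triple set) \<Rightarrow> bool" where
  "minima_exist P T UT \<longleftrightarrow>
     (\<forall>t\<le>T. \<forall>X\<in>payoffs P T t. \<forall>h\<in>histories P t.
        \<exists>m\<in>premium_values P T UT t X h. \<forall>v\<in>premium_values P T UT t X h. m \<le> v)"

text \<open>
  The minimum is rendered by \<open>Least\<close>, as \<open>Min\<close> is meaningful for finite sets only; it is the minimum
  whenever that exists.
\<close>

definition induced_risk ::
  "('s, 'x) trajectory measure \<Rightarrow> nat \<Rightarrow>
   (nat \<Rightarrow> ('s, 'x) trajectory \<Rightarrow> ('s, 'x) triple set) \<Rightarrow>
   nat \<Rightarrow> ('s, 'x) process \<Rightarrow> ('s, 'x) trajectory \<Rightarrow> real" where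
  "induced_risk P T UT t X = (\<lambda>\<omega>. LEAST v. v \<in> premium_values P T UT t X (hist t \<omega>))"

definition time_consistent ::
  "('s, 'x) trajectory measure \<Rightarrow> nat \<Rightarrow>
   (nat \<Rightarrow> ('s, 'x) process \<Rightarrow> ('s, 'x) trajectory \<Rightarrow> real) \<Rightarrow> bool" where
  "time_consistent P T \<rho> \<longleftrightarrow>
     (\<forall>t1 t2. t1 < t2 \<longrightarrow> t2 \<le> T \<longrightarrow> (\<forall>X\<in>payoffs P T t1. \<forall>Y\<in>payoffs P T t1.
        (\<forall>k\<in>{t1..<t2}. AE \<omega> in P. X k \<omega> = Y k \<omega>) \<longrightarrow>
        (AE \<omega> in P. \<rho> t2 X \<omega> \<le> \<rho> t2 Y \<omega>) \<longrightarrow>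
        (AE \<omega> in P. \<rho> t1 X \<omega> \<le> \<rho> t1 Y \<omega>)))"

definition paste :: "nat \<Rightarrow> ('s, 'x) process \<Rightarrow> ('s, 'x) process \<Rightarrow> ('s, 'x) process" where
  "paste t A B = (\<lambda>k. if k < t then A k else B k)"

end

theory Submission
  imports Defs
begin

text \<open>
  Let \<open>(Z, \<Phi>)\<close> be optimal for \<open>Y\<close> from \<open>t\<^sub>1\<close> on and \<open>(Z', \<Phi>')\<close> optimal for \<open>X\<close> from \<open>t\<^sub>2\<close> on, at every
  history at once; this is possible because the minimizers found at the individual histories glue
  together to adapted processes.  The tail of \<open>(Y, Z, \<Phi>)\<close> is acceptable from \<open>t\<^sub>2\<close> on, so
  \<open>\<Phi>'\<^bsub>t2\<^esub> = \<rho>\<^bsub>t2\<^esub>(X) \<le> \<rho>\<^bsub>t2\<^esub>(Y) \<le> \<Phi>\<^bsub>t2\<^esub>\<close> and the two triples may be pasted at \<open>t\<^sub>2\<close>.  The result is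
  acceptable for \<open>X\<close> from \<open>t\<^sub>1\<close> on with initial premium \<open>\<Phi>\<^bsub>t1\<^esub> = \<rho>\<^bsub>t1\<^esub>(Y)\<close>.
\<close>

lemma hist_hist: "t \<le> k \<Longrightarrow> hist t (hist k \<omega>) = hist t \<omega>"
  by (simp add: hist_def min_absorb1)

lemma hist_eq_mono:
  assumes "t \<le> k" and "hist k \<omega> = hist k \<omega>'"
  shows "hist t \<omega> = hist t \<omega>'"
  using assms hist_hist by metis

text \<open>The sets of \<open>hist_algebra P t\<close> are exactly the unions of fibres of
  \<open>hist t\<close>, as the sigma-algebra pulled back is discrete. So measurability amounts to
  constancy on fibres, with no exceptional null set.\<close>

lemma Linf_iff:
  "Y \<in> Linf P t \<longleftrightarrow>
     (\<forall>\<omega>\<in>space P. \<forall>\<omega>'\<in>space P. hist t \<omega> = hist t \<omega>' \<longrightarrow> Y \<omega> = Y \<omega>')"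
proof
  assume Y: "Y \<in> Linf P t"
  show "\<forall>\<omega>\<in>space P. \<forall>\<omega>'\<in>space P. hist t \<omega> = hist t \<omega>' \<longrightarrow> Y \<omega> = Y \<omega>'"
  proof (intro ballI impI)
    fix \<omega> \<omega>' assume \<omega>: "\<omega> \<in> space P" "\<omega>' \<in> space P" "hist t \<omega> = hist t \<omega>'"
    have "Y -` {Y \<omega>} \<inter> space (hist_algebra P t) \<in> sets (hist_algebra P t)"
      using Y unfolding Linf_def by (rule measurable_sets) simp
    then obtain A where "Y -` {Y \<omega>} \<inter> space P = hist t -` A \<inter> space P"
      unfolding hist_algebra_def by (auto simp: sets_vimage_algebra2)
    then show "Y \<omega> = Y \<omega>'"
      using \<omega> by (metis Int_iff singletonD singletonI vimage_eq)
  qed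
next
  assume Y: "\<forall>\<omega>\<in>space P. \<forall>\<omega>'\<in>space P. hist t \<omega> = hist t \<omega>' \<longrightarrow> Y \<omega> = Y \<omega>'"
  show "Y \<in> Linf P t"
    unfolding Linf_def
  proof (rule measurableI)
    fix B :: "real set"
    have "Y -` B \<inter> space P = hist t -` (hist t ` (Y -` B \<inter> space P)) \<inter> space P"
      using Y by fastforce
    then show "Y -` B \<inter> space (hist_algebra P t) \<in> sets (hist_algebra P t)"
      unfolding hist_algebra_def by (auto simp: sets_vimage_algebra2)
  qed simp
qed

lemma adapted_mono: "s \<le> t \<Longrightarrow> adapted P T s \<subseteq> adapted P T t"
  by (auto simp: adapted_def)

lemma payoffs_mono: "s \<le> t \<Longrightarrow> payoffs P T s \<subseteq> payoffs P T t"
  by (auto simp: payoffs_def)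

lemma adapted_paste:
  assumes "Z \<in> adapted P T s" and "Z' \<in> adapted P T t"
  shows "paste t Z Z' \<in> adapted P T s"
  using assms by (auto simp: adapted_def paste_def)

text \<open>From time \<open>t\<close> on, \<open>hist k \<omega>\<close> determines
  \<open>hist t \<omega>\<close>. Hence the selected index is constant on each fibre of
  \<open>hist k\<close>, and there a single adapted process is followed.\<close>

lemma adapted_glue:
  assumes "\<And>h. A h \<in> adapted P T t"
  shows "(\<lambda>k \<omega>. A (hist t \<omega>) k \<omega>) \<in> adapted P T t"
  unfolding adapted_def
proof (intro CollectI ballI)
  fix k assume k: "k \<in> {t..T}"
  have "A h k \<in> Linf P k" for h
    using assms k by (auto simp: adapted_def)
  then show "(\<lambda>\<omega>. A (hist t \<omega>) k \<omega>) \<in> Linf P k"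
    using k hist_eq_mono[of t k] unfolding Linf_iff by (metis atLeastAtMost_iff)
qed

text \<open>Both sides vanish off the fibre of \<open>h\<close>, and on it the index
  \<open>hist t \<omega>\<close> is \<open>h\<close>.\<close>

lemma cond_proc_glue: "cond_proc t h (\<lambda>k \<omega>. A (hist t \<omega>) k \<omega>) = cond_proc t h (A h)"
  by (auto simp: cond_proc_def fun_eq_iff)

lemma hist_val_glue: "hist_val P t (\<lambda>\<omega>. Y (hist t \<omega>) \<omega>) h = hist_val P t (Y h) h"
  unfolding hist_val_def by (rule arg_cong[where f = The]) auto

lemma Linf_restrict:
  assumes "t \<le> k" and "Y \<in> Linf P k"
  shows "(\<lambda>\<omega>. if hist t \<omega> = h then Y \<omega> else 0) \<in> Linf P k"
  using assms hist_eq_mono[of t k] unfolding Linf_iff by metis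

lemma cond_triple_in_triples:
  assumes "W \<in> triples P T t"
  shows "cond_triple t h W \<in> triples P T t"
  using assms
  by (auto simp: triples_def payoffs_def adapted_def cond_triple_def cond_proc_def
      intro!: Linf_restrict)

text \<open>Almost sure equality survives restriction to a fibre, and \<open>A\<close> is saturated
  under it. This is needed because payoffs that agree before the pasting time do so only almost
  surely.\<close>

lemma cond_triple_cong_payoff:
  assumes A: "Linf_triple_set P T t A"
    and "cond_triple t h (X, Z, \<Phi>) \<in> A"
    and X': "(X', Z, \<Phi>) \<in> triples P T t"
    and eq: "proc_eq P T t X X'"
  shows "cond_triple t h (X', Z, \<Phi>) \<in> A"
proof -
  have "proc_eq P T t (cond_proc t h X) (cond_proc t h X')"
    using eq by (auto simp: proc_eq_def cond_proc_def elim!: AE_mp)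
  moreover have "proc_eq P T t B B" for B
    by (simp add: proc_eq_def)
  ultimately show ?thesis
    using assms(1,2) cond_triple_in_triples[OF X', of h]
    unfolding Linf_triple_set_def cond_triple_def by simp
qed

text \<open>A fibre of positive probability meets every almost sure event, and the null fibres are
  finitely many, so they can be discarded together. This trades the almost sure inequalities in
  \<open>time_consistent\<close> for inequalities at each history.\<close>

lemma AE_hist_iff:
  assumes "prob_space P" and fin: "finite (space P)" and sets: "sets P = Pow (space P)"
  shows "(AE \<omega> in P. Q (hist t \<omega>)) \<longleftrightarrow> (\<forall>h\<in>histories P t. Q h)"
proof -
  interpret prob_space P by fact
  have fiber: "{\<omega> \<in> space P. hist t \<omega> = h} \<in> events" for h
    using sets by auto
  show ?thesis
  proof (intro iffI ballI)
    fix h assume AE: "AE \<omega> in P. Q (hist t \<omega>)" and h: "h \<in> histories P t"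
    show "Q h"
    proof (rule ccontr)
      assume "\<not> Q h"
      then have "AE \<omega> in P. hist t \<omega> \<noteq> h"
        using AE by (auto elim!: AE_mp)
      then have "prob {\<omega> \<in> space P. hist t \<omega> = h} = 0"
        using prob_eq_0[OF fiber] by (auto elim!: AE_mp)
      then show False
        using h by (simp add: histories_def)
    qed
  next
    assume Q: "\<forall>h\<in>histories P t. Q h"
    have "AE \<omega> in P. hist t \<omega> = h \<longrightarrow> h \<in> histories P t" for h
    proof (cases "h \<in> histories P t")
      case False
      then have "prob {\<omega> \<in> space P. hist t \<omega> = h} = 0"
        by (simp add: histories_def zero_less_measure_iff)
      then have "AE \<omega> in P. hist t \<omega> \<noteq> h"
        using prob_eq_0[OF fiber, of h] by simp
      then show ?thesis
        by (rule eventually_mono) simp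
    qed simp
    then have "AE \<omega> in P. \<forall>h\<in>hist t ` space P. hist t \<omega> = h \<longrightarrow> h \<in> histories P t"
      using fin by (intro AE_finite_allI) auto
    then show "AE \<omega> in P. Q (hist t \<omega>)"
      using AE_space Q by (auto elim!: AE_mp)
  qed
qed

text \<open>\<open>LEAST\<close> on a set of reals is specified only when the set has a least
  element, which \<open>minima_exist\<close> supplies.\<close>

lemma Least_premium_value:
  assumes "minima_exist P T UT" and "t \<le> T" and "X \<in> payoffs P T t" and "h \<in> histories P t"
  shows "(LEAST v. v \<in> premium_values P T UT t X h) \<in> premium_values P T UT t X h"
    and "v \<in> premium_values P T UT t X h \<Longrightarrow> (LEAST v. v \<in> premium_values P T UT t X h) \<le> v"
proof -
  obtain m where m: "m \<in> premium_values P T UT t X h"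
    "\<And>v. v \<in> premium_values P T UT t X h \<Longrightarrow> m \<le> v"
    using assms unfolding minima_exist_def by blast
  then have "(LEAST v. v \<in> premium_values P T UT t X h) = m"
    by (intro Least_equality)
  with m show "(LEAST v. v \<in> premium_values P T UT t X h) \<in> premium_values P T UT t X h"
    and "v \<in> premium_values P T UT t X h \<Longrightarrow> (LEAST v. v \<in> premium_values P T UT t X h) \<le> v"
    by simp_all
qed

lemma adapted_minimizers_exist:
  assumes "minima_exist P T UT" and "t \<le> T" and "X \<in> payoffs P T t"
  obtains Z \<Phi> where "Z \<in> adapted P T t" and "\<Phi> \<in> adapted P T t"
    and "\<And>h. h \<in> histories P t \<Longrightarrow> cond_triple t h (X, Z, \<Phi>) \<in> UT t h"
    and "\<And>h. h \<in> histories P t \<Longrightarrow>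
           hist_val P t (\<Phi> t) h = (LEAST v. v \<in> premium_values P T UT t X h)"
proof -
  have "\<exists>Z \<Phi>. Z \<in> adapted P T t \<and> \<Phi> \<in> adapted P T t \<and>
      (h \<in> histories P t \<longrightarrow> cond_triple t h (X, Z, \<Phi>) \<in> UT t h \<and>
        hist_val P t (\<Phi> t) h = (LEAST v. v \<in> premium_values P T UT t X h))" for h
  proof (cases "h \<in> histories P t")
    case True
    then have "(LEAST v. v \<in> premium_values P T UT t X h) \<in> premium_values P T UT t X h"
      using Least_premium_value(1) assms by blast
    then obtain Z \<Phi> where "Z \<in> adapted P T t" "\<Phi> \<in> adapted P T t"
      "cond_triple t h (X, Z, \<Phi>) \<in> UT t h"
      "(LEAST v. v \<in> premium_values P T UT t X h) = hist_val P t (\<Phi> t) h"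
      \<comment> \<open>Only the outer occurrence is unfolded, so that the minimum itself stays
        folded.\<close>
      by (subst (asm) (2) premium_values_def) blast
    then show ?thesis by auto
  next
    case False
    \<comment> \<open>At a history of probability zero any adapted process serves; gluing asks for
      one at every index.\<close>
    have "(\<lambda>k \<omega>. 0) \<in> adapted P T t"
      by (simp add: adapted_def Linf_iff)
    with False show ?thesis by blast
  qed
  \<comment> \<open>The axiom of choice turns the minimizers into families indexed by
    histories.\<close>
  then obtain Z \<Phi> where opt: "\<And>h. Z h \<in> adapted P T t" "\<And>h. \<Phi> h \<in> adapted P T t"
    "\<And>h. h \<in> histories P t \<Longrightarrow> cond_triple t h (X, Z h, \<Phi> h) \<in> UT t h"
    "\<And>h. h \<in> histories P t \<Longrightarrow>
       hist_val P t (\<Phi> h t) h = (LEAST v. v \<in> premium_values P T UT t X h)"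
    by metis
  show thesis
  proof (rule that)
    show "(\<lambda>k \<omega>. Z (hist t \<omega>) k \<omega>) \<in> adapted P T t" "(\<lambda>k \<omega>. \<Phi> (hist t \<omega>) k \<omega>) \<in> adapted P T t"
      using opt(1,2) by (auto intro: adapted_glue)
    fix h assume h: "h \<in> histories P t"
    show "cond_triple t h (X, \<lambda>k \<omega>. Z (hist t \<omega>) k \<omega>, \<lambda>k \<omega>. \<Phi> (hist t \<omega>) k \<omega>) \<in> UT t h"
      using opt(3)[OF h] by (simp add: cond_triple_def cond_proc_glue)
    show "hist_val P t (\<lambda>\<omega>. \<Phi> (hist t \<omega>) t \<omega>) h = (LEAST v. v \<in> premium_values P T UT t X h)"
      using opt(4)[OF h] hist_val_glue[of P t "\<lambda>h. \<Phi> h t" h] by simp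
  qed
qed

theorem theorem16:
  fixes s0 :: "'s::finite" and T :: nat
    and P :: "('s, 'x::finite) trajectory measure"
    and U :: "('s, 'x) triple set"
    and UT :: "nat \<Rightarrow> ('s, 'x) trajectory \<Rightarrow> ('s, 'x) triple set"
  assumes prob: "prob_space P"
    and sets_P: "sets P = Pow (trajectories s0 T)"
    and frontier: "risk_frontier P T U"
    and decomposition: "temporal_decomposition P T U UT"
    and nested: "nested_tails P T UT"
    and minima: "minima_exist P T UT"
    and pasting:
      "\<And>t1 t2 X Z \<Phi> X' Z' \<Phi>'.
         \<lbrakk>t1 < t2; t2 \<le> T;
          (X, Z, \<Phi>) \<in> triples P T t1;
          \<And>h. h \<in> histories P t1 \<Longrightarrow> cond_triple t1 h (X, Z, \<Phi>) \<in> UT t1 h;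
          (X', Z', \<Phi>') \<in> triples P T t2;
          \<And>h. h \<in> histories P t2 \<Longrightarrow> cond_triple t2 h (X', Z', \<Phi>') \<in> UT t2 h;
          \<And>h. h \<in> histories P t2 \<Longrightarrow> hist_val P t2 (\<Phi>' t2) h \<le> hist_val P t2 (\<Phi> t2) h\<rbrakk>
         \<Longrightarrow> \<forall>h\<in>histories P t1.
               cond_triple t1 h (paste t2 X X', paste t2 Z Z', paste t2 \<Phi> \<Phi>') \<in> UT t1 h"
  shows "time_consistent P T (induced_risk P T UT)"
proof -
  have space: "space P = trajectories s0 T"
    using sets_P by (metis Pow_top Sup_upper Union_Pow_eq sets.sets_into_space sets.top subset_antisym)
  have "finite (space P)"
  proof (rule finite_subset)
    show "space P \<subseteq> {s0} \<times> {xs :: 'x list. set xs \<subseteq> UNIV \<and> length xs = Suc T}"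
      by (auto simp: space trajectories_def)
  qed (intro finite_cartesian_product finite_lists_length_eq; simp)
  note AE_iff = AE_hist_iff[OF prob this sets_P[folded space]]
  let ?risk = "\<lambda>t X h. LEAST v. v \<in> premium_values P T UT t X h"
  show ?thesis
    unfolding time_consistent_def
  proof (intro allI impI ballI)
    fix t1 t2 :: nat and X Y :: "('s, 'x) process"
    assume t: "t1 < t2" "t2 \<le> T" and X: "X \<in> payoffs P T t1" and Y: "Y \<in> payoffs P T t1"
      and XY: "\<forall>k\<in>{t1..<t2}. AE \<omega> in P. X k \<omega> = Y k \<omega>"
      and "AE \<omega> in P. induced_risk P T UT t2 X \<omega> \<le> induced_risk P T UT t2 Y \<omega>"
    \<comment> \<open>\<open>induced_risk\<close> depends on \<open>\<omega>\<close> only through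
      the history, so the comparison holds at each history of positive probability.\<close>
    then have risk_le: "?risk t2 X h \<le> ?risk t2 Y h" if "h \<in> histories P t2" for h
      using AE_iff[where Q = "\<lambda>h. ?risk t2 X h \<le> ?risk t2 Y h"] that
      unfolding induced_risk_def by blast
    have X2: "X \<in> payoffs P T t2" and Y2: "Y \<in> payoffs P T t2"
      using X Y payoffs_mono[of t1 t2 P T] t by auto
    obtain Z \<Phi> where Z: "Z \<in> adapted P T t1" and \<Phi>: "\<Phi> \<in> adapted P T t1"
      and acc: "\<And>h. h \<in> histories P t1 \<Longrightarrow> cond_triple t1 h (Y, Z, \<Phi>) \<in> UT t1 h"
      and opt: "\<And>h. h \<in> histories P t1 \<Longrightarrow> hist_val P t1 (\<Phi> t1) h = ?risk t1 Y h"
      using adapted_minimizers_exist[OF minima _ Y] t by auto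
    obtain Z' \<Phi>' where Z': "Z' \<in> adapted P T t2" and \<Phi>': "\<Phi>' \<in> adapted P T t2"
      and acc': "\<And>h. h \<in> histories P t2 \<Longrightarrow> cond_triple t2 h (X, Z', \<Phi>') \<in> UT t2 h"
      and opt': "\<And>h. h \<in> histories P t2 \<Longrightarrow> hist_val P t2 (\<Phi>' t2) h = ?risk t2 X h"
      using adapted_minimizers_exist[OF minima t(2) X2] by auto
    let ?Z = "paste t2 Z Z'" and ?\<Phi> = "paste t2 \<Phi> \<Phi>'"
    have tri: "(Y, Z, \<Phi>) \<in> triples P T t1" and tri': "(X, Z', \<Phi>') \<in> triples P T t2"
      using Y Z \<Phi> X2 Z' \<Phi>' by (auto simp: triples_def)
    have premium_le: "hist_val P t2 (\<Phi>' t2) h \<le> hist_val P t2 (\<Phi> t2) h"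
      if h: "h \<in> histories P t2" for h
    proof -
      \<comment> \<open>Although chosen for time \<open>t1\<close>, \<open>(Z, \<Phi>)\<close> is
        feasible at \<open>t2\<close> by nestedness, so \<open>\<Phi> t2\<close> bounds the risk of
        \<open>Y\<close> there from above.\<close>
      have "cond_triple t2 h (Y, Z, \<Phi>) \<in> UT t2 h"
        using nested tri acc t h unfolding nested_tails_def by blast
      moreover have "Z \<in> adapted P T t2" "\<Phi> \<in> adapted P T t2"
        using Z \<Phi> adapted_mono[of t1 t2 P T] t by auto
      ultimately have "hist_val P t2 (\<Phi> t2) h \<in> premium_values P T UT t2 Y h"
        unfolding premium_values_def by blast
      then have "?risk t2 Y h \<le> hist_val P t2 (\<Phi> t2) h"
        by (rule Least_premium_value(2)[OF minima t(2) Y2 h])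
      with risk_le[OF h] opt'[OF h] show ?thesis by simp
    qed
    have pasted: "\<forall>h\<in>histories P t1. cond_triple t1 h (paste t2 Y X, ?Z, ?\<Phi>) \<in> UT t1 h"
      by (rule pasting[OF t tri acc tri' acc' premium_le])
    have tri1: "(X, ?Z, ?\<Phi>) \<in> triples P T t1"
      using X Z \<Phi> Z' \<Phi>' by (auto simp: triples_def adapted_paste)
    \<comment> \<open>The pasted payoff is \<open>Y\<close> before \<open>t2\<close>, where it
      agrees with \<open>X\<close> almost surely, and literally \<open>X\<close> from
      \<open>t2\<close> on.\<close>
    have "AE \<omega> in P. Y k \<omega> = X k \<omega>" if "k \<in> {t1..<t2}" for k
      using bspec[OF XY that] by (rule eventually_mono) simp
    then have eq: "proc_eq P T t1 (paste t2 Y X) X"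
      by (simp add: proc_eq_def paste_def)
    have "?risk t1 X h \<le> ?risk t1 Y h" if h: "h \<in> histories P t1" for h
    proof -
      have "Linf_triple_set P T t1 (UT t1 h)"
        using decomposition t h unfolding temporal_decomposition_def by simp
      then have "cond_triple t1 h (X, ?Z, ?\<Phi>) \<in> UT t1 h"
        using cond_triple_cong_payoff pasted h tri1 eq by blast
      then have "hist_val P t1 (?\<Phi> t1) h \<in> premium_values P T UT t1 X h"
        using tri1 unfolding premium_values_def triples_def by blast
      then have "?risk t1 X h \<le> hist_val P t1 (?\<Phi> t1) h"
        using Least_premium_value(2)[OF minima _ X h] t by simp
      \<comment> \<open>As \<open>t1 < t2\<close> strictly, pasting leaves the premium at
        \<open>t1\<close> unchanged, and that premium is optimal for \<open>Y\<close>.\<close>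
      also have "\<dots> = ?risk t1 Y h"
        using opt[OF h] t by (simp add: paste_def)
      finally show ?thesis .
    qed
    then show "AE \<omega> in P. induced_risk P T UT t1 X \<omega> \<le> induced_risk P T UT t1 Y \<omega>"
      unfolding induced_risk_def using AE_iff[where Q = "\<lambda>h. ?risk t1 X h \<le> ?risk t1 Y h"] by blast
  qed
qed

end
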